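(* Let $X$ be a quasi-compact topological space and let $\kappa=|\pi_0(X)|$ be the cardinality (possibly infinite) of the set of connected components of $X$. Then the following assertions are equivalent: (i) $X$ has finitely many connected components. (ii) There is an isomorphism of rings $\operatorname{Clop}(X)\simeq\prod_{\kappa}\mathbb{Z}/2$. (iii) $\operatorname{Clop}(X)$ has cardinality $2^{\kappa}$. (iv) There is an isomorphism of rings $H_0(X)\simeq\prod_{\kappa}\mathbb{Z}$. (v) The connected components of $X$ are exactly the primitive idempotents of $\operatorname{Clop}(X)$. (vi) Every connected component of $X$ is an open subset of $X$.
   Context: Quasi-compact means every open cover has a finite subcover (no Hausdorff condition). $\pi_0(X)$ is the set of connected components of $X$. $\operatorname{Clop}(X)$ is the Boolean ring of all clopen (both open and closed) subsets of $X$, with addition $A+B=(A\cup B)\setminus(A\cap B)$ and multiplication $A\cdot B=A\cap B$. $H_0(X)$ is the ring of all continuous functions $X\to\mathbb{Z}$, where $\mathbb{Z}$ is discrete, with pointwise addition and multiplication. $\prod_\kappa$ denotes the direct product of $\kappa$ copies. A primitive idempotent of a commutative ring $R$ is a nonzero idempotent $e\in R$ such that if $ee'=e'$ for some nonzero idempotent $e'\in R$, then $e=e'$. Connected spaces are nonempty by convention. *)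

theory Defs
  imports "HOL-Analysis.Analysis" "HOL-Algebra.IntRing"
begin

unbundle cardinal_syntax

definition clopen_ring :: "'a topology \<Rightarrow> 'a set ring"
  where "clopen_ring X =
    \<lparr>carrier = {A. openin X A \<and> closedin X A},
     mult = (\<lambda>A B. A \<inter> B), one = topspace X,
     zero = {}, add = (\<lambda>A B. (A \<union> B) - (A \<inter> B))\<rparr>"

text \<open>
  Functions on the underlying set of \<open>X\<close> are represented by the total functions that are
  \<open>undefined\<close> outside \<open>topspace X\<close>, so that equality of ring elements is
  equality of functions on \<open>X\<close>.
\<close>
definition H0_ring :: "'a topology \<Rightarrow> ('a \<Rightarrow> int) ring"
  where "H0_ring X =
    \<lparr>carrier = {f \<in> extensional (topspace X). continuous_map X (discrete_topology UNIV) f},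
     mult = (\<lambda>f g. \<lambda>x\<in>topspace X. f x * g x), one = (\<lambda>x\<in>topspace X. 1),
     zero = (\<lambda>x\<in>topspace X. 0), add = (\<lambda>f g. \<lambda>x\<in>topspace X. f x + g x)\<rparr>"

definition product_ring :: "'i set \<Rightarrow> ('i \<Rightarrow> ('a, 'm) ring_scheme) \<Rightarrow> ('i \<Rightarrow> 'a) ring"
  where "product_ring I R =
    \<lparr>carrier = (\<Pi>\<^sub>E i\<in>I. carrier (R i)),
     mult = (\<lambda>x y. \<lambda>i\<in>I. x i \<otimes>\<^bsub>R i\<^esub> y i), one = (\<lambda>i\<in>I. \<one>\<^bsub>R i\<^esub>),
     zero = (\<lambda>i\<in>I. \<zero>\<^bsub>R i\<^esub>), add = (\<lambda>x y. \<lambda>i\<in>I. x i \<oplus>\<^bsub>R i\<^esub> y i)\<rparr>"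

definition primitive_idempotent :: "('a, 'm) ring_scheme \<Rightarrow> 'a \<Rightarrow> bool"
  where "primitive_idempotent R e \<longleftrightarrow>
    e \<in> carrier R \<and> e \<noteq> \<zero>\<^bsub>R\<^esub> \<and> e \<otimes>\<^bsub>R\<^esub> e = e \<and>
    (\<forall>e'\<in>carrier R. e' \<noteq> \<zero>\<^bsub>R\<^esub> \<and> e' \<otimes>\<^bsub>R\<^esub> e' = e' \<and> e \<otimes>\<^bsub>R\<^esub> e' = e' \<longrightarrow> e = e')"

lemma cring_clopen_ring: "cring (clopen_ring X)"
proof (rule cringI)
  show "abelian_group (clopen_ring X)"
  proof (rule abelian_groupI)
    show "\<exists>B\<in>carrier (clopen_ring X). B \<oplus>\<^bsub>clopen_ring X\<^esub> A = \<zero>\<^bsub>clopen_ring X\<^esub>"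
      if "A \<in> carrier (clopen_ring X)" for A
      using that by (intro bexI[of _ A]) (auto simp: clopen_ring_def)
  qed (auto simp: clopen_ring_def)
  show "comm_monoid (clopen_ring X)"
    by (rule comm_monoidI) (auto simp: clopen_ring_def dest: openin_subset)
qed (auto simp: clopen_ring_def)

lemma continuous_map_discrete_binop:
  assumes "continuous_map X (discrete_topology UNIV) f"
    and "continuous_map X (discrete_topology UNIV) g"
  shows "continuous_map X (discrete_topology UNIV) (\<lambda>x\<in>topspace X. op2 (f x) (g x))"
proof -
  have "openin X {x \<in> topspace X. op2 (f x) (g x) \<in> U}" for U
  proof -
    have "{x \<in> topspace X. op2 (f x) (g x) \<in> U} =
      (\<Union>(a, b) \<in> {(a, b). op2 a b \<in> U}.
         {x \<in> topspace X. f x \<in> {a}} \<inter> {x \<in> topspace X. g x \<in> {b}})"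
      by auto
    moreover have "openin X {x \<in> topspace X. f x \<in> {a}}" "openin X {x \<in> topspace X. g x \<in> {b}}"
      for a b
      by (rule assms[THEN openin_continuous_map_preimage]; simp)+
    ultimately show ?thesis
      by (auto intro!: openin_Union openin_Int)
  qed
  then have "continuous_map X (discrete_topology UNIV) (\<lambda>x. op2 (f x) (g x))"
    by (auto simp: continuous_map_def)
  then show ?thesis
    by (rule continuous_map_eq) simp
qed

lemma cring_H0_ring: "cring (H0_ring X)"
proof -
  let ?D = "discrete_topology (UNIV :: int set)"
  have const: "continuous_map X ?D (\<lambda>x\<in>topspace X. c)" for c
    by (rule continuous_map_eq[of _ _ "\<lambda>x. c"]) auto
  note closed = const continuous_map_discrete_binop[of X _ _ "(+)"]
    continuous_map_discrete_binop[of X _ _ "(*)"]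
  note closed = closed[unfolded restrict_def]
  show ?thesis
  proof (rule cringI)
    show "abelian_group (H0_ring X)"
    proof (rule abelian_groupI)
      show "\<exists>g\<in>carrier (H0_ring X). g \<oplus>\<^bsub>H0_ring X\<^esub> f = \<zero>\<^bsub>H0_ring X\<^esub>"
        if "f \<in> carrier (H0_ring X)" for f
        using that continuous_map_discrete_binop[of X f f "\<lambda>a b. - a"]
        by (intro bexI[of _ "\<lambda>x\<in>topspace X. - f x"]) (auto simp: H0_ring_def)
    qed (auto simp: H0_ring_def closed fun_eq_iff extensional_def restrict_def)
    show "comm_monoid (H0_ring X)"
      by (rule comm_monoidI)
        (auto simp: H0_ring_def closed fun_eq_iff extensional_def restrict_def)
  qed (auto simp: H0_ring_def fun_eq_iff restrict_def algebra_simps)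
qed

lemma cring_product_ring:
  assumes "\<And>i. i \<in> I \<Longrightarrow> cring (R i)"
  shows "cring (product_ring I R)"
proof (rule cringI)
  note rings = assms[THEN cring.axioms(1)]
  show "abelian_group (product_ring I R)"
  proof (rule abelian_groupI)
    show "\<exists>y\<in>carrier (product_ring I R). y \<oplus>\<^bsub>product_ring I R\<^esub> x = \<zero>\<^bsub>product_ring I R\<^esub>"
      if "x \<in> carrier (product_ring I R)" for x
      using that
      by (intro bexI[of _ "\<lambda>i\<in>I. \<ominus>\<^bsub>R i\<^esub> x i"])
        (auto simp: product_ring_def PiE_iff ring.ring_simprules[OF rings] intro!: restrict_ext)
  qed (auto simp: product_ring_def PiE_iff fun_eq_iff extensional_def restrict_def
        ring.ring_simprules[OF rings])
  show "comm_monoid (product_ring I R)"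
    by (rule comm_monoidI)
      (auto simp: product_ring_def PiE_iff fun_eq_iff extensional_def restrict_def
        cring.cring_simprules[OF assms] monoid.r_one[OF ring.is_monoid[OF rings]])
qed (auto simp: product_ring_def PiE_iff fun_eq_iff restrict_def cring.cring_simprules[OF assms])

end

theory Submission
  imports Defs "HOL-Algebra.Free_Abelian_Groups"
begin

text \<open>
  A clopen set is the union of the connected components it contains. If all components are open,
  then conversely every union of components is clopen, and a continuous integer-valued function is
  an arbitrary function that is constant on components; all the assertions follow.
  By compactness, openness of the components is equivalent to their number \<open>\<kappa>\<close> being finite.
  If \<open>\<kappa>\<close> is infinite, compactness yields at most \<open>\<kappa>\<close> clopen sets,
  whereas a ring isomorphic to a product of \<open>\<kappa>\<close> nonzero rings has at least
  \<open>2\<^sup>\<kappa>\<close> idempotents, and the idempotents of both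
  rings correspond to clopen sets.
\<close>

section \<open>Clopen sets and connected components\<close>

abbreviation clopens :: "'a topology \<Rightarrow> 'a set set"
  where "clopens X \<equiv> {A. openin X A \<and> closedin X A}"

lemma clopen_component_cases:
  assumes "openin X A" "closedin X A" "C \<in> connected_components_of X"
  shows "C \<subseteq> A \<or> C \<inter> A = {}"
  using connectedin_clopen_cases[OF connectedin_connected_components_of[OF assms(3)] assms(2,1)]
  by (auto simp: disjnt_def)

lemma connected_components_of_eqI:
  assumes "C \<in> connected_components_of X" "D \<in> connected_components_of X" "x \<in> C" "x \<in> D"
  shows "C = D"
  using pairwise_disjoint_connected_components_of[of X] assms
  by (auto simp: pairwise_def disjnt_iff)

lemma clopen_contains_component:
  assumes "openin X A" "closedin X A" "x \<in> A"
  obtains C where "C \<in> connected_components_of X" "x \<in> C" "C \<subseteq> A"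
proof -
  obtain C where "C \<in> connected_components_of X" "x \<in> C"
    using assms(3) openin_subset[OF assms(1)] Union_connected_components_of[of X] by blast
  then show thesis
    using clopen_component_cases[OF assms(1,2), of C] assms(3) that by blast
qed

lemma Union_components_of_clopen:
  assumes "openin X A" "closedin X A"
  shows "\<Union>{C \<in> connected_components_of X. C \<subseteq> A} = A"
  using clopen_contains_component[OF assms] by blast

text \<open>Components are nonempty and pairwise disjoint, so one that lies in
  \<open>\<Union>U\<close> meets, and hence equals, a member of \<open>U\<close>. A family of
  components can thus be recovered from its union.\<close>

lemma components_subset_Union_components:
  assumes "U \<subseteq> connected_components_of X"
  shows "{C \<in> connected_components_of X. C \<subseteq> \<Union>U} = U"
proof -
  have "C \<in> U" if "C \<in> connected_components_of X" "C \<subseteq> \<Union>U" for C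
  proof -
    have "C \<noteq> {}"
      using that(1) by (rule nonempty_connected_components_of)
    with that(2) obtain x D where "x \<in> C" "D \<in> U" "x \<in> D"
      by blast
    moreover from this have "C = D"
      using that(1) assms by (intro connected_components_of_eqI[of C X D x]) auto
    ultimately show ?thesis
      by simp
  qed
  then show ?thesis
    using assms by blast
qed

text \<open>Compactness in indexed form: the finite subcover comes as a finite set of indices,
  because the encoding of clopen sets records indices and not the covering sets.\<close>

lemma compactin_finite_subcover_image:
  assumes "compactin X A" "\<And>i. i \<in> I \<Longrightarrow> openin X (P i)" "A \<subseteq> (\<Union>i\<in>I. P i)"
  obtains J where "finite J" "J \<subseteq> I" "A \<subseteq> (\<Union>i\<in>J. P i)"
proof -
  have "\<exists>F. finite F \<and> F \<subseteq> P ` I \<and> A \<subseteq> \<Union>F"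
    using assms(2,3) by (intro compactinD[OF assms(1)]) auto
  then obtain F where F: "finite F" "F \<subseteq> P ` I" "A \<subseteq> \<Union>F"
    by blast
  obtain J where "J \<subseteq> I" "finite J" "F = P ` J"
    using finite_subset_image[OF F(1,2)] by blast
  with F(3) show ?thesis
    by (intro that) auto
qed

text \<open>Components are always closed, and the complement of \<open>C\<close> is a finite union
  of the others.\<close>

lemma components_open_if_finite:
  assumes "finite (connected_components_of X)" "C \<in> connected_components_of X"
  shows "openin X C"
proof -
  have "closedin X (\<Union>(connected_components_of X - {C}))"
    using assms(1) by (intro closedin_Union) (auto simp: closedin_connected_components_of)
  then have "openin X (topspace X - (topspace X - C))"
    unfolding complement_connected_components_of_Union[OF assms(2), symmetric]
    by (intro openin_diff) auto
  then show ?thesis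
    using connected_components_of_subset[OF assms(2)] by (simp add: double_diff)
qed

text \<open>Open components form an open cover. A finite subcover must contain all of them, since
  each is nonempty and disjoint from the others.\<close>

lemma finite_components_if_open:
  assumes "compact_space X" "\<And>C. C \<in> connected_components_of X \<Longrightarrow> openin X C"
  shows "finite (connected_components_of X)"
proof -
  have "\<exists>U. finite U \<and> U \<subseteq> connected_components_of X \<and> topspace X \<subseteq> \<Union>U"
    using assms by (intro compactinD) (auto simp: compact_space_def Union_connected_components_of)
  then obtain U where U: "finite U" "U \<subseteq> connected_components_of X" "topspace X \<subseteq> \<Union>U"
    by (elim exE conjE)
  have "connected_components_of X \<subseteq> {C \<in> connected_components_of X. C \<subseteq> \<Union>U}"
    using U(3) connected_components_of_subset by blast
  then show ?thesis
    using U(1) unfolding components_subset_Union_components[OF U(2)] by (rule finite_subset)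
qed

section \<open>Counting clopen sets\<close>

lemma card_of_Pow_cexp: "|Pow A| =o ctwo ^c |A|"
  unfolding cexp_def ctwo_def by (simp add: card_of_Pow_Func)

text \<open>
  Fix, for each ordered pair of components that some clopen set separates, one such clopen
  set \<open>S C D\<close>. By compactness every clopen set is a finite union of finite
  intersections of these, hence is encoded by a finite set of pairs of components.
\<close>
lemma card_clopens_le_card_components:
  assumes "compact_space X" "infinite (connected_components_of X)"
  shows "|clopens X| \<le>o |connected_components_of X|"
proof -
  let ?K = "connected_components_of X"
  define sep where "sep C D S \<longleftrightarrow> S \<in> clopens X \<and> C \<subseteq> S \<and> D \<inter> S = {}" for C D S
  \<comment> \<open>For a pair that no clopen set separates, the default \<open>topspace X\<close>
    keeps \<open>S C D\<close> clopen and, for a component \<open>C\<close>, a superset of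
    \<open>C\<close>.\<close>
  define S where "S C D = (if \<exists>S. sep C D S then SOME S. sep C D S else topspace X)" for C D
  \<comment> \<open>Decoding of a finite relation \<open>F\<close>: each element \<open>C\<close> of
    its domain yields the intersection of the \<open>S C D\<close> over the nonempty row of
    \<open>C\<close>, and these are united.\<close>
  define g where "g F = (\<Union>C\<in>fst ` F. \<Inter>D\<in>F `` {C}. S C D)" for F
  have sep_S: "sep C D (S C D)" if "sep C D A" for C D A
    unfolding S_def using that by (auto intro: someI)
  have clopen_S: "openin X (S C D)" "closedin X (S C D)" for C D
    using sep_S[of C D] by (cases "\<exists>A. sep C D A"; force simp: sep_def S_def)+
  have subset_S: "C \<subseteq> S C D" if "C \<in> ?K" for C D
    using sep_S[of C D] connected_components_of_subset[OF that]
    by (cases "\<exists>A. sep C D A"; force simp: sep_def S_def)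
  have "A \<in> g ` Fpow (?K \<times> ?K)" if A: "openin X A" "closedin X A" for A
  proof -
    \<comment> \<open>First use of compactness, on the complement of \<open>A\<close>: finitely many
      \<open>S C D\<close> suffice to squeeze the neighbourhood of \<open>C\<close> into
      \<open>A\<close>.\<close>
    have "\<forall>C\<in>{C \<in> ?K. C \<subseteq> A}. \<exists>G. finite G \<and> G \<noteq> {} \<and> G \<subseteq> ?K \<and> (\<Inter>D\<in>G. S C D) \<subseteq> A"
    proof
      fix C assume C: "C \<in> {C \<in> ?K. C \<subseteq> A}"
      have "compactin X (topspace X - A)"
        using A assms(1) by (intro closedin_compact_space) auto
      moreover have "openin X (topspace X - S C D)" if "D \<in> {D \<in> ?K. D \<inter> A = {}}" for D
        using clopen_S by auto
      moreover have "topspace X - A \<subseteq> (\<Union>D\<in>{D \<in> ?K. D \<inter> A = {}}. topspace X - S C D)"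
      proof
        fix x assume x: "x \<in> topspace X - A"
        then obtain D where D: "D \<in> ?K" "x \<in> D"
          using Union_connected_components_of[of X] by blast
        then have "D \<inter> A = {}"
          using clopen_component_cases[OF A D(1)] x by blast
        \<comment> \<open>\<open>A\<close> itself separates \<open>C\<close> from \<open>D\<close>,
          so the chosen set \<open>S C D\<close> does as well.\<close>
        moreover from this have "sep C D A"
          using A C by (auto simp: sep_def)
        then have "sep C D (S C D)"
          by (rule sep_S)
        ultimately show "x \<in> (\<Union>D\<in>{D \<in> ?K. D \<inter> A = {}}. topspace X - S C D)"
          using D x by (auto simp: sep_def)
      qed
      ultimately obtain G where G: "finite G" "G \<subseteq> {D \<in> ?K. D \<inter> A = {}}"
          "topspace X - A \<subseteq> (\<Union>D\<in>G. topspace X - S C D)"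
        by (rule compactin_finite_subcover_image)
      \<comment> \<open>\<open>G\<close> can be empty if \<open>A\<close> is the whole space, and
        the empty intersection would be \<open>UNIV\<close>. The extra index \<open>C\<close> makes
        the family nonempty and confines the intersection to \<open>topspace X\<close>.\<close>
      have "(\<Inter>D\<in>insert C G. S C D) \<subseteq> A"
        using G(3) openin_subset[OF clopen_S(1)[of C C]] by blast
      with G C show "\<exists>G. finite G \<and> G \<noteq> {} \<and> G \<subseteq> ?K \<and> (\<Inter>D\<in>G. S C D) \<subseteq> A"
        by (intro exI[of _ "insert C G"]) auto
    qed
    from bchoice[OF this] obtain G where
      "\<forall>C\<in>{C \<in> ?K. C \<subseteq> A}. finite (G C) \<and> G C \<noteq> {} \<and> G C \<subseteq> ?K \<and> (\<Inter>D\<in>G C. S C D) \<subseteq> A" ..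
    then have G: "finite (G C)" "G C \<noteq> {}" "G C \<subseteq> ?K" "(\<Inter>D\<in>G C. S C D) \<subseteq> A"
      if "C \<in> {C \<in> ?K. C \<subseteq> A}" for C
      using that by simp_all
    let ?P = "\<lambda>C. \<Inter>D\<in>G C. S C D"
    \<comment> \<open>Second use of compactness, on \<open>A\<close> itself, covered by the
      neighbourhoods \<open>?P C\<close> of its components.\<close>
    have "compactin X A"
      using assms(1) A(2) by (rule closedin_compact_space)
    moreover have "openin X (?P C)" if "C \<in> {C \<in> ?K. C \<subseteq> A}" for C
      using G(1,2)[OF that] clopen_S(1) by (intro openin_Inter) auto
    moreover have "A \<subseteq> (\<Union>C\<in>{C \<in> ?K. C \<subseteq> A}. ?P C)"
    proof
      fix x assume "x \<in> A"
      with A obtain C where C: "C \<in> ?K" "x \<in> C" "C \<subseteq> A"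
        by (rule clopen_contains_component)
      then have "x \<in> ?P C"
        using subset_S by auto
      with C show "x \<in> (\<Union>C\<in>{C \<in> ?K. C \<subseteq> A}. ?P C)"
        by (intro UN_I[of C]) simp_all
    qed
    ultimately obtain H where H: "finite H" "H \<subseteq> {C \<in> ?K. C \<subseteq> A}" "A \<subseteq> (\<Union>C\<in>H. ?P C)"
      by (rule compactin_finite_subcover_image)
    have GH: "finite (G C)" "G C \<noteq> {}" "G C \<subseteq> ?K" "?P C \<subseteq> A" if "C \<in> H" for C
      using G[of C] subsetD[OF H(2) that] by simp_all
    \<comment> \<open>No index of \<open>H\<close> is lost in the set of pairs because every
      \<open>G C\<close> is nonempty.\<close>
    have "fst ` Sigma H G = H"
      using GH(2) by force
    then have "g (Sigma H G) = (\<Union>C\<in>H. \<Inter>D\<in>Sigma H G `` {C}. S C D)"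
      by (simp add: g_def)
    also have "\<dots> = (\<Union>C\<in>H. ?P C)"
      by (intro SUP_cong INF_cong) auto
    also have "\<dots> = A"
      using H(3) GH(4) by (intro equalityI UN_least)
    finally have "A = g (Sigma H G)" ..
    moreover have "Sigma H G \<in> Fpow (?K \<times> ?K)"
      using H(1,2) GH(1,3) by (force simp: Fpow_def)
    ultimately show ?thesis
      by (rule image_eqI)
  qed
  then have "|clopens X| \<le>o |g ` Fpow (?K \<times> ?K)|"
    by (intro card_of_mono1) blast
  also have "|g ` Fpow (?K \<times> ?K)| \<le>o |Fpow (?K \<times> ?K)|"
    by (rule card_of_image)
  also have "|Fpow (?K \<times> ?K)| =o |?K \<times> ?K|"
    using assms(2) by (intro card_of_Fpow_infinite) (auto simp: finite_cartesian_product_iff)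
  also have "|?K \<times> ?K| =o |?K|"
    using assms(2) by (rule card_of_Times_same_infinite)
  finally show ?thesis .
qed

text \<open>Cantor's theorem makes the preceding bound strict against the power set.\<close>

lemma card_clopens_less:
  assumes "compact_space X" "infinite (connected_components_of X)"
  shows "|clopens X| <o |Pow (connected_components_of X)|"
  using card_clopens_le_card_components[OF assms] card_of_Pow by (rule ordLeq_ordLess_trans)

section \<open>Idempotents\<close>

text \<open>The indicator vectors of subsets of \<open>I\<close> are idempotents of the product,
  distinct because 1 differs from 0 in \<open>S\<close>. The isomorphism pulls them back to
  idempotents of \<open>R\<close>.\<close>

lemma card_idempotents_iso_product:
  assumes "cring R" "cring S" "\<one>\<^bsub>S\<^esub> \<noteq> \<zero>\<^bsub>S\<^esub>" "R \<simeq> product_ring I (\<lambda>_. S)"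
  shows "|Pow I| \<le>o |{e \<in> carrier R. e \<otimes>\<^bsub>R\<^esub> e = e}|"
proof -
  interpret R: cring R by fact
  interpret S: cring S by fact
  let ?P = "product_ring I (\<lambda>_. S)"
  define e where "e J = (\<lambda>i\<in>I. if i \<in> J then \<one>\<^bsub>S\<^esub> else \<zero>\<^bsub>S\<^esub>)" for J
  obtain h where h: "h \<in> ring_iso R ?P"
    using assms(4) by (auto simp: is_ring_iso_def)
  then have bij: "bij_betw h (carrier R) (carrier ?P)"
    by (rule ring_iso_memE(5))
  have e: "e J \<in> carrier ?P" "e J \<otimes>\<^bsub>?P\<^esub> e J = e J" for J
    by (auto simp: product_ring_def e_def intro!: restrict_ext)
  have "e J \<in> h ` {e \<in> carrier R. e \<otimes>\<^bsub>R\<^esub> e = e}" for J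
  proof -
    obtain r where r: "r \<in> carrier R" "e J = h r"
      using bij e(1)[of J] by (auto simp: bij_betw_def)
    \<comment> \<open>Multiplicativity turns idempotence of \<open>e J\<close> into an equation
      between values of \<open>h\<close>, and injectivity then makes \<open>r\<close>
      idempotent.\<close>
    then have "h (r \<otimes>\<^bsub>R\<^esub> r) = h r"
      using e(2)[of J] ring_iso_memE(2)[OF h] by simp
    then have "r \<otimes>\<^bsub>R\<^esub> r = r"
      using bij_betw_imp_inj_on[OF bij] r(1) by (auto dest: inj_onD)
    with r show ?thesis by blast
  qed
  moreover have "inj_on e (Pow I)"
  proof (rule inj_onI)
    have "J = {i \<in> I. e J i = \<one>\<^bsub>S\<^esub>}" if "J \<in> Pow I" for J
      using that assms(3) by (auto simp: e_def)
    then show "J = J'" if "J \<in> Pow I" "J' \<in> Pow I" "e J = e J'" for J J'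
      using that by metis
  qed
  ultimately have "|Pow I| \<le>o |h ` {e \<in> carrier R. e \<otimes>\<^bsub>R\<^esub> e = e}|"
    by (intro card_of_ordLeqI) auto
  also have "|h ` {e \<in> carrier R. e \<otimes>\<^bsub>R\<^esub> e = e}| \<le>o |{e \<in> carrier R. e \<otimes>\<^bsub>R\<^esub> e = e}|"
    by (rule card_of_image)
  finally show ?thesis .
qed

lemma idempotents_clopen_ring:
  "{A \<in> carrier (clopen_ring X). A \<otimes>\<^bsub>clopen_ring X\<^esub> A = A} = clopens X"
  by (auto simp: clopen_ring_def)

text \<open>An idempotent integer is 0 or 1, so an idempotent function is determined by the set
  where it equals 1. This set is clopen, being the preimage of a clopen set under a continuous
  map.\<close>

lemma card_idempotents_H0_ring:
  "|{f \<in> carrier (H0_ring X). f \<otimes>\<^bsub>H0_ring X\<^esub> f = f}| \<le>o |clopens X|" (is "|?E| \<le>o _")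
proof (rule card_of_ordLeqI)
  let ?z = "\<lambda>f. {x \<in> topspace X. f x \<in> {1 :: int}}"
  have E: "f \<in> extensional (topspace X)" "continuous_map X (discrete_topology UNIV) f"
      "x \<in> topspace X \<Longrightarrow> f x = 0 \<or> f x = 1" if "f \<in> ?E" for f x
  proof -
    show "f \<in> extensional (topspace X)" "continuous_map X (discrete_topology UNIV) f"
      using that by (auto simp: H0_ring_def)
    assume x: "x \<in> topspace X"
    have "(\<lambda>x\<in>topspace X. f x * f x) x = f x"
      using that by (simp add: H0_ring_def)
    with x show "f x = 0 \<or> f x = 1" by simp
  qed
  show "inj_on ?z ?E"
  proof (rule inj_onI)
    fix f f' assume f: "f \<in> ?E" "f' \<in> ?E" "?z f = ?z f'"
    show "f = f'"
    proof (rule extensionalityI[OF E(1)[OF f(1)] E(1)[OF f(2)]])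
      show "f x = f' x" if "x \<in> topspace X" for x
      proof -
        have "f x = 1 \<longleftrightarrow> f' x = 1"
          using f(3) that by (auto simp: set_eq_iff)
        then show ?thesis
          using E(3)[OF f(1) that] E(3)[OF f(2) that] by auto
      qed
    qed
  qed
  show "?z f \<in> clopens X" if "f \<in> ?E" for f
    using openin_continuous_map_preimage[OF E(2)[OF that], of "{1}"]
      closedin_continuous_map_preimage[OF E(2)[OF that], of "{1}"] by auto
qed

text \<open>An isomorphism would supply at least \<open>|Pow (connected_components_of X)|\<close>
  idempotents, but every idempotent is a clopen set and there are strictly fewer of those.\<close>

lemma not_clopen_ring_iso_product:
  assumes "compact_space X" "infinite (connected_components_of X)" "cring S" "\<one>\<^bsub>S\<^esub> \<noteq> \<zero>\<^bsub>S\<^esub>"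
  shows "\<not> clopen_ring X \<simeq> product_ring (connected_components_of X) (\<lambda>_. S)"
  using card_idempotents_iso_product[OF cring_clopen_ring assms(3,4)]
    card_clopens_less[OF assms(1,2)] not_ordLess_ordLeq
  unfolding idempotents_clopen_ring by blast

text \<open>The same contradiction, with idempotent functions injected into the clopen sets.\<close>

lemma not_H0_ring_iso_product:
  assumes "compact_space X" "infinite (connected_components_of X)" "cring S" "\<one>\<^bsub>S\<^esub> \<noteq> \<zero>\<^bsub>S\<^esub>"
  shows "\<not> H0_ring X \<simeq> product_ring (connected_components_of X) (\<lambda>_. S)"
  using card_idempotents_iso_product[OF cring_H0_ring assms(3,4)]
    card_clopens_less[OF assms(1,2)] not_ordLess_ordLeq
    ordLeq_transitive[OF _ card_idempotents_H0_ring] by blast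

section \<open>Spaces with open components\<close>

locale open_components =
  fixes X :: "'a topology"
  assumes openin_component: "C \<in> connected_components_of X \<Longrightarrow> openin X C"
begin

text \<open>The complement of \<open>\<Union>U\<close> is the union of the remaining components, so
  both are unions of open sets.\<close>

lemma Union_components_clopen:
  assumes "U \<subseteq> connected_components_of X"
  shows "\<Union>U \<in> clopens X"
proof -
  have "topspace X - \<Union>U = \<Union>(connected_components_of X - U)"
    unfolding Union_connected_components_of[symmetric]
    by (rule diff_Union_pairwise_disjoint[OF pairwise_disjoint_connected_components_of assms])
  moreover have "openin X (\<Union>(connected_components_of X - U))" "openin X (\<Union>U)"
    using assms openin_component by (auto intro!: openin_Union)
  ultimately show ?thesis
    by (auto simp: closedin_def openin_subset)
qed

lemma bij_betw_clopens_Pow: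
  "bij_betw (\<lambda>A. {C \<in> connected_components_of X. C \<subseteq> A}) (clopens X)
    (Pow (connected_components_of X))"
proof (rule bij_betw_byWitness[where f' = Union])
  show "\<forall>A\<in>clopens X. \<Union>{C \<in> connected_components_of X. C \<subseteq> A} = A"
    by (simp add: Union_components_of_clopen)
  show "\<forall>U\<in>Pow (connected_components_of X). {C \<in> connected_components_of X. C \<subseteq> \<Union>U} = U"
    using components_subset_Union_components by blast
  show "Union ` Pow (connected_components_of X) \<subseteq> clopens X"
    using Union_components_clopen by blast
qed blast

lemma card_clopens: "|clopens X| =o |Pow (connected_components_of X)|"
  using bij_betw_clopens_Pow by (rule card_of_ordIsoI)

text \<open>A clopen set is sent to its indicator function on the set of components. Taking any ring
  with just the two elements 0 and 1 keeps the coset representation of \<open>ZFact 2\<close> out of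
  the argument.\<close>

lemma clopen_ring_iso_product:
  assumes "cring S" and carrier: "carrier S = {\<zero>\<^bsub>S\<^esub>, \<one>\<^bsub>S\<^esub>}" and "\<one>\<^bsub>S\<^esub> \<noteq> \<zero>\<^bsub>S\<^esub>"
  shows "clopen_ring X \<simeq> product_ring (connected_components_of X) (\<lambda>_. S)"
proof -
  interpret S: cring S by fact
  let ?K = "connected_components_of X"
  define h where "h A = (\<lambda>C\<in>?K. if C \<subseteq> A then \<one>\<^bsub>S\<^esub> else \<zero>\<^bsub>S\<^esub>)" for A
  \<comment> \<open>The sum is 0 or 1, and cancellation rules out 1.\<close>
  have one_add_one: "\<one>\<^bsub>S\<^esub> \<oplus>\<^bsub>S\<^esub> \<one>\<^bsub>S\<^esub> = \<zero>\<^bsub>S\<^esub>"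
    using carrier assms(3) S.add.l_cancel_one[of "\<one>\<^bsub>S\<^esub>" "\<one>\<^bsub>S\<^esub>"] S.a_closed[of "\<one>\<^bsub>S\<^esub>" "\<one>\<^bsub>S\<^esub>"] by auto
  \<comment> \<open>A component is nonempty and lies entirely inside or outside each clopen set.
    Containment in the symmetric difference is therefore an exclusive or, which is addition in
    \<open>S\<close>.\<close>
  have sym_diff: "C \<subseteq> A \<union> B - A \<inter> B \<longleftrightarrow> (C \<subseteq> A) \<noteq> (C \<subseteq> B)"
    if "C \<in> ?K" "A \<in> clopens X" "B \<in> clopens X" for A B C
  proof -
    have "C \<noteq> {}"
      using that(1) by (rule nonempty_connected_components_of)
    moreover have "C \<subseteq> A \<or> C \<inter> A = {}" "C \<subseteq> B \<or> C \<inter> B = {}"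
      using that clopen_component_cases[of X A C] clopen_component_cases[of X B C] by simp_all
    ultimately show ?thesis by blast
  qed
  have "h \<in> ring_iso (clopen_ring X) (product_ring ?K (\<lambda>_. S))"
  proof (rule ring_iso_memI)
    show "bij_betw h (carrier (clopen_ring X)) (carrier (product_ring ?K (\<lambda>_. S)))"
    proof (rule bij_betw_byWitness[where f' = "\<lambda>u. \<Union>{C \<in> ?K. u C = \<one>\<^bsub>S\<^esub>}"])
      have "{C \<in> ?K. h A C = \<one>\<^bsub>S\<^esub>} = {C \<in> ?K. C \<subseteq> A}" for A
        using assms(3) by (auto simp: h_def)
      then show "\<forall>A\<in>carrier (clopen_ring X). \<Union>{C \<in> ?K. h A C = \<one>\<^bsub>S\<^esub>} = A"
        by (simp add: clopen_ring_def Union_components_of_clopen)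
      show "\<forall>u\<in>carrier (product_ring ?K (\<lambda>_. S)). h (\<Union>{C \<in> ?K. u C = \<one>\<^bsub>S\<^esub>}) = u"
      proof
        fix u assume u: "u \<in> carrier (product_ring ?K (\<lambda>_. S))"
        let ?U = "{C \<in> ?K. u C = \<one>\<^bsub>S\<^esub>}"
        have "C \<subseteq> \<Union>?U \<longleftrightarrow> C \<in> ?U" if "C \<in> ?K" for C
          using components_subset_Union_components[of ?U X] that by blast
        moreover have "u C = \<zero>\<^bsub>S\<^esub> \<or> u C = \<one>\<^bsub>S\<^esub>" if "C \<in> ?K" for C
          using u that carrier by (auto simp: product_ring_def PiE_iff)
        moreover have "u \<in> extensional ?K"
          using u by (auto simp: product_ring_def PiE_iff)
        ultimately show "h (\<Union>?U) = u"
          by (intro extensionalityI[of _ ?K]) (fastforce simp: h_def)+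
      qed
      show "h ` carrier (clopen_ring X) \<subseteq> carrier (product_ring ?K (\<lambda>_. S))"
        by (auto simp: h_def product_ring_def)
      show "(\<lambda>u. \<Union>{C \<in> ?K. u C = \<one>\<^bsub>S\<^esub>}) ` carrier (product_ring ?K (\<lambda>_. S)) \<subseteq> carrier (clopen_ring X)"
        using Union_components_clopen by (force simp: clopen_ring_def)
    qed
    show "h \<one>\<^bsub>clopen_ring X\<^esub> = \<one>\<^bsub>product_ring ?K (\<lambda>_. S)\<^esub>"
      by (simp add: h_def clopen_ring_def product_ring_def connected_components_of_subset
        cong: restrict_cong)
    fix A B assume "A \<in> carrier (clopen_ring X)" "B \<in> carrier (clopen_ring X)"
    then have AB: "A \<in> clopens X" "B \<in> clopens X"
      by (auto simp: clopen_ring_def)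
    show "h A \<in> carrier (product_ring ?K (\<lambda>_. S))"
      by (auto simp: h_def product_ring_def)
    show "h (A \<otimes>\<^bsub>clopen_ring X\<^esub> B) = h A \<otimes>\<^bsub>product_ring ?K (\<lambda>_. S)\<^esub> h B"
      by (auto simp: h_def clopen_ring_def product_ring_def intro!: restrict_ext)
    show "h (A \<oplus>\<^bsub>clopen_ring X\<^esub> B) = h A \<oplus>\<^bsub>product_ring ?K (\<lambda>_. S)\<^esub> h B"
      using sym_diff[OF _ AB]
      by (auto simp: h_def clopen_ring_def product_ring_def one_add_one intro!: restrict_ext)
  qed
  then show ?thesis
    by (auto simp: is_ring_iso_def)
qed

text \<open>A continuous function to a discrete space is constant on each component, so it is
  recovered from its values at one point per component. Openness of the components makes every
  choice of values continuous.\<close>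

lemma H0_ring_iso_product:
  "H0_ring X \<simeq> product_ring (connected_components_of X) (\<lambda>_. \<Z>)"
proof -
  let ?K = "connected_components_of X" and ?P = "product_ring (connected_components_of X) (\<lambda>_. \<Z>)"
  define p where "p C = (SOME x. x \<in> C)" for C :: "'a set"
  define h where "h f = (\<lambda>C\<in>?K. f (p C) :: int)" for f
  \<comment> \<open>The inverse of \<open>h\<close>: composition with the map from a point to its
    component, made \<open>undefined\<close> off the space to be extensional.\<close>
  define k where "k u = (\<lambda>x\<in>topspace X. u (connected_component_of_set X x) :: int)" for u
  have p: "p C \<in> C" "p C \<in> topspace X" if "C \<in> ?K" for C
  proof -
    show "p C \<in> C"
      using nonempty_connected_components_of[OF that] by (simp add: p_def some_in_eq)
    then show "p C \<in> topspace X"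
      using connected_components_of_subset[OF that] by blast
  qed
  have component: "connected_component_of_set X x = C" if "C \<in> ?K" "x \<in> C" for C x
    using connected_components_of_eqI[OF _ that(1) _ that(2), of "connected_component_of_set X x"]
      connected_components_of_subset[OF that(1)] that(2)
    by (auto simp: connected_component_in_connected_components_of connected_component_of_refl)
  have const: "f x = f y"
    if "continuous_map X (discrete_topology UNIV) f" "C \<in> ?K" "x \<in> C" "y \<in> C"
    for f :: "'a \<Rightarrow> int" and C x y
  proof -
    \<comment> \<open>The level set of \<open>f\<close> through \<open>y\<close> is clopen, so it
      contains the whole component of \<open>y\<close>.\<close>
    let ?A = "{z \<in> topspace X. f z \<in> {f y}}"
    have "C \<subseteq> ?A \<or> C \<inter> ?A = {}"
      using openin_continuous_map_preimage[OF that(1), of "{f y}"]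
        closedin_continuous_map_preimage[OF that(1), of "{f y}"] that(2)
      by (intro clopen_component_cases) simp_all
    then show ?thesis
      using that connected_components_of_subset[OF that(2)] by auto
  qed
  have "h \<in> ring_iso (H0_ring X) ?P"
  proof (rule ring_iso_memI)
    show "bij_betw h (carrier (H0_ring X)) (carrier ?P)"
    proof (rule bij_betw_byWitness[where f' = k])
      show "\<forall>f\<in>carrier (H0_ring X). k (h f) = f"
      proof
        fix f assume "f \<in> carrier (H0_ring X)"
        then have f: "f \<in> extensional (topspace X)" "continuous_map X (discrete_topology UNIV) f"
          by (auto simp: H0_ring_def)
        have "k (h f) x = f x" if "x \<in> topspace X" for x
        proof -
          have C: "connected_component_of_set X x \<in> ?K"
            using that by (simp add: connected_component_in_connected_components_of)
          moreover have "x \<in> connected_component_of_set X x"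
            using that by (simp add: connected_component_of_refl)
          ultimately show ?thesis
            using const[OF f(2) C p(1)[OF C]] that by (simp add: k_def h_def)
        qed
        then show "k (h f) = f"
          by (intro extensionalityI[OF _ f(1)]) (auto simp: k_def)
      qed
      show "\<forall>u\<in>carrier ?P. h (k u) = u"
      proof
        fix u assume "u \<in> carrier ?P"
        then have "u \<in> extensional ?K"
          by (auto simp: product_ring_def PiE_iff)
        then show "h (k u) = u"
          using p component by (intro extensionalityI[of _ ?K]) (auto simp: h_def k_def)
      qed
      show "h ` carrier (H0_ring X) \<subseteq> carrier ?P"
        by (auto simp: h_def product_ring_def int_carrier_eq)
      \<comment> \<open>The preimage of \<open>V\<close> is the union of the components whose value
        lies in \<open>V\<close>, hence open.\<close>
      have "openin X {x \<in> topspace X. k u x \<in> V}" for u V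
      proof -
        have "x \<in> \<Union>{C \<in> ?K. u C \<in> V} \<longleftrightarrow> x \<in> topspace X \<and> k u x \<in> V" for x
        proof -
          have "x \<in> topspace X \<longleftrightarrow> (\<exists>C\<in>?K. x \<in> C)"
            using Union_connected_components_of[of X] by blast
          then show ?thesis
            using component[of _ x] by (auto simp: k_def)
        qed
        then have "{x \<in> topspace X. k u x \<in> V} = \<Union>{C \<in> ?K. u C \<in> V}"
          by blast
        then show ?thesis
          using openin_component by (auto intro!: openin_Union)
      qed
      then show "k ` carrier ?P \<subseteq> carrier (H0_ring X)"
        by (auto simp: H0_ring_def continuous_map_def) (auto simp: k_def)
    qed
    show "h \<one>\<^bsub>H0_ring X\<^esub> = \<one>\<^bsub>?P\<^esub>"
      using p by (auto simp: h_def H0_ring_def product_ring_def intro!: restrict_ext)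
    fix f g assume "f \<in> carrier (H0_ring X)" "g \<in> carrier (H0_ring X)"
    show "h f \<in> carrier ?P"
      by (auto simp: h_def product_ring_def int_carrier_eq)
    show "h (f \<otimes>\<^bsub>H0_ring X\<^esub> g) = h f \<otimes>\<^bsub>?P\<^esub> h g"
      using p by (auto simp: h_def H0_ring_def product_ring_def intro!: restrict_ext)
    show "h (f \<oplus>\<^bsub>H0_ring X\<^esub> g) = h f \<oplus>\<^bsub>?P\<^esub> h g"
      using p by (auto simp: h_def H0_ring_def product_ring_def intro!: restrict_ext)
  qed
  then show ?thesis
    by (auto simp: is_ring_iso_def)
qed

text \<open>In the clopen ring the product condition means inclusion, so primitive idempotents are
  the minimal nonempty clopen sets. Open components are clopen and minimal, and every nonempty
  clopen set contains one.\<close>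

lemma components_eq_primitive_idempotents:
  "connected_components_of X = {e. primitive_idempotent (clopen_ring X) e}"
proof (intro equalityI subsetI)
  fix C assume C: "C \<in> connected_components_of X"
  have "C = A" if "A \<in> clopens X" "A \<noteq> {}" "C \<inter> A = A" for A
    using clopen_component_cases[of X A C] that C by blast
  then show "C \<in> {e. primitive_idempotent (clopen_ring X) e}"
    using openin_component[OF C] closedin_connected_components_of[OF C]
      nonempty_connected_components_of[OF C]
    by (auto simp: primitive_idempotent_def clopen_ring_def)
next
  fix A assume "A \<in> {e. primitive_idempotent (clopen_ring X) e}"
  then have A: "A \<in> clopens X" "A \<noteq> {}"
    and min: "\<And>B. B \<in> clopens X \<Longrightarrow> B \<noteq> {} \<Longrightarrow> A \<inter> B = B \<Longrightarrow> A = B"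
    by (auto simp: primitive_idempotent_def clopen_ring_def)
  obtain C where C: "C \<in> connected_components_of X" "C \<subseteq> A"
    using clopen_contains_component[of X A] A by blast
  then have "A = C"
    using openin_component[OF C(1)] closedin_connected_components_of[OF C(1)]
      nonempty_connected_components_of[OF C(1)]
    by (intro min) auto
  with C show "A \<in> connected_components_of X" by simp
qed

end

section \<open>The ring of integers modulo 2\<close>

lemma ZFact_two:
  "carrier (ZFact 2) = {\<zero>\<^bsub>ZFact 2\<^esub>, \<one>\<^bsub>ZFact 2\<^esub>}" "\<one>\<^bsub>ZFact 2\<^esub> \<noteq> \<zero>\<^bsub>ZFact 2\<^esub>"
proof -
  have I: "Idl\<^bsub>\<Z>\<^esub> {2} = {x. even x}"
    by (auto simp: int_Idl)
  \<comment> \<open>Membership in the coset of \<open>a\<close> means an even difference from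
    \<open>a\<close>, so a coset depends only on the parity of \<open>a\<close>. The two elements of
    the quotient are the even and the odd integers.\<close>
  have coset: "Idl\<^bsub>\<Z>\<^esub> {2} +>\<^bsub>\<Z>\<^esub> a = {x. even x = even a}" for a
  proof -
    have "x \<in> Idl\<^bsub>\<Z>\<^esub> {2} +>\<^bsub>\<Z>\<^esub> a \<longleftrightarrow> even (x - a)" for x
      unfolding I a_r_coset_def r_coset_def by (auto intro: exI[of _ "x - a"])
    then show ?thesis by auto
  qed
  have zero: "\<zero>\<^bsub>ZFact 2\<^esub> = {x. even x}"
    by (simp add: ZFact_defs I)
  have one: "\<one>\<^bsub>ZFact 2\<^esub> = {x. odd x}"
    by (simp add: ZFact_defs coset)
  have "carrier (ZFact 2) = range (\<lambda>a :: int. {x :: int. even x = even a})"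
    by (simp add: ZFact_defs A_RCOSETS_def' coset UNION_singleton_eq_range)
  also have "\<dots> = {{x. even x}, {x. odd x}}"
  proof
    show "range (\<lambda>a :: int. {x :: int. even x = even a}) \<subseteq> {{x. even x}, {x :: int. odd x}}"
    proof
      fix A assume "A \<in> range (\<lambda>a :: int. {x :: int. even x = even a})"
      then obtain a :: int where "A = {x. even x = even a}" by blast
      then show "A \<in> {{x. even x}, {x :: int. odd x}}"
        by (cases "even a") simp_all
    qed
    show "{{x. even x}, {x :: int. odd x}} \<subseteq> range (\<lambda>a :: int. {x :: int. even x = even a})"
      using range_eqI[of "{x. even x}" "\<lambda>a :: int. {x :: int. even x = even a}" 0]
        range_eqI[of "{x. odd x}" "\<lambda>a :: int. {x :: int. even x = even a}" 1] by simp
  qed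
  finally show "carrier (ZFact 2) = {\<zero>\<^bsub>ZFact 2\<^esub>, \<one>\<^bsub>ZFact 2\<^esub>}"
    by (simp add: zero one)
  show "\<one>\<^bsub>ZFact 2\<^esub> \<noteq> \<zero>\<^bsub>ZFact 2\<^esub>"
    unfolding zero one by force
qed

section \<open>Equivalence with finiteness, by the finite and infinite cases\<close>

theorem theorem5p6:
  fixes X :: "'a topology"
  assumes "compact_space X"
  shows "(finite (connected_components_of X) \<longleftrightarrow>
      clopen_ring X \<simeq> product_ring (connected_components_of X) (\<lambda>_. ZFact 2))
    \<and> (finite (connected_components_of X) \<longleftrightarrow>
      |carrier (clopen_ring X)| =o ctwo ^c |connected_components_of X| )
    \<and> (finite (connected_components_of X) \<longleftrightarrow>
      H0_ring X \<simeq> product_ring (connected_components_of X) (\<lambda>_. \<Z>))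
    \<and> (finite (connected_components_of X) \<longleftrightarrow>
      connected_components_of X = {e. primitive_idempotent (clopen_ring X) e})
    \<and> (finite (connected_components_of X) \<longleftrightarrow>
      (\<forall>C\<in>connected_components_of X. openin X C))"
proof -
  have carrier: "carrier (clopen_ring X) = clopens X"
    by (simp add: clopen_ring_def)
  show ?thesis
  proof (cases "finite (connected_components_of X)")
    case True
    then interpret open_components X
      by unfold_locales (rule components_open_if_finite)
    have "|carrier (clopen_ring X)| =o ctwo ^c |connected_components_of X|"
      unfolding carrier using card_clopens card_of_Pow_cexp by (rule ordIso_transitive)
    then show ?thesis
      using True clopen_ring_iso_product[OF ZFact_is_cring ZFact_two] H0_ring_iso_product
        components_eq_primitive_idempotents openin_component by blast
  next
    case False
    then have not_open: "\<not> (\<forall>C\<in>connected_components_of X. openin X C)"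
      using finite_components_if_open[OF assms] by blast
    have "\<not> |clopens X| =o ctwo ^c |connected_components_of X|"
      using ordLess_ordIso_trans[OF card_clopens_less[OF assms False] card_of_Pow_cexp]
        not_ordLess_ordIso by blast
    \<comment> \<open>Primitive idempotents belong to the clopen ring, so equality would make every
      component open.\<close>
    moreover have "connected_components_of X \<noteq> {e. primitive_idempotent (clopen_ring X) e}"
      using not_open by (auto simp: primitive_idempotent_def clopen_ring_def)
    ultimately show ?thesis
      using False not_open carrier not_clopen_ring_iso_product[OF assms False ZFact_is_cring ZFact_two(2)]
        not_H0_ring_iso_product[OF assms False int.cring_axioms] by auto
  qed
qed

end
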